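(* Let $A \in \mathbb{R}^{n \times n}$ and let $J$ be a nonempty proper subset of $\langle n \rangle = \{1,\dots,n\}$ (so $n \ge 2$). Let $\mathbb{J} = \{x \in \mathbb{R}^n : x_j > 0 \text{ for all } j \in J \text{ and } x_j < 0 \text{ for all } j \in \langle n\rangle \setminus J\}$. Then $A$ is an almost $P$-matrix of the first category with respect to $J$ if and only if the following three conditions hold: (a) $N(A) \cap \mathbb{J} = \emptyset$; (b) for every $x \in \mathbb{R}^n$ with $x_i (Ax)_i \le 0$ for all $i \in \langle n \rangle$: if $x_k = 0$ for some $k$, then $x = 0$; otherwise $x \in \mathbb{J}$ or $-x \in \mathbb{J}$; (c) $A(\mathbb{J}) \cap (-\mathbb{J}) \neq \emptyset$.
   Context: A matrix $A \in \mathbb{R}^{n\times n}$ with $n \ge 2$ is an almost $P$-matrix if all its proper principal minors are positive and $\det A < 0$ (in particular $A$ is invertible). A real $n \times n$ matrix is an $N$-matrix if all its principal minors (including the determinant) are negative. Write $J^\complement = \langle n \rangle \setminus J$, and let $M_{KL}$ denote the submatrix of $M$ with rows indexed by $K$ and columns indexed by $L$; matrix inequalities are entrywise. For a nonempty proper subset $J$ of $\langle n\rangle$, an $N$-matrix $M \in \mathbb{R}^{n \times n}$ is of the first category with respect to $J$ if $M_{JJ} < 0$, $M_{J^\complement J^\complement} < 0$, $M_{J J^\complement} > 0$ and $M_{J^\complement J} > 0$. An almost $P$-matrix $A$ is of the first category with respect to $J$ if $A^{-1}$ is an $N$-matrix of the first category with respect to $J$. $N(A)$ denotes the null space of $A$;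 $A(S) = \{Ax : x \in S\}$ and $-S = \{-x : x \in S\}$. *)

theory Defs
  imports "HOL-Analysis.Analysis"
begin

text \<open>The index set \<open>{1,\<dots>,n}\<close> is a finite type \<open>'n\<close>.  The submatrix with rows and columns in
  \<open>K\<close> is not itself a value of a matrix type, so its determinant is given by the Leibniz
  formula, i.e. the library definition of \<open>det\<close> with \<open>UNIV\<close> replaced by \<open>K\<close>.\<close>

definition principal_minor :: "real^'n^'n \<Rightarrow> 'n set \<Rightarrow> real" where
  "principal_minor A K = (\<Sum>p | p permutes K. of_int (sign p) * (\<Prod>i\<in>K. A $ i $ p i))"

lemma principal_minor_UNIV: "principal_minor A UNIV = det A"
  by (simp add: principal_minor_def det_def)

lemma principal_minor_singleton: "principal_minor A {i} = A $ i $ i"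
proof -
  have "{p. p permutes {i}} = {id}"
    by (auto simp: permutes_sing)
  then show ?thesis
    by (simp add: principal_minor_def)
qed

definition almost_P_matrix :: "real^'n^'n \<Rightarrow> bool" where
  "almost_P_matrix A \<longleftrightarrow> CARD('n) \<ge> 2 \<and>
     (\<forall>K. K \<noteq> {} \<and> K \<noteq> UNIV \<longrightarrow> principal_minor A K > 0) \<and> det A < 0"

definition N_matrix :: "real^'n^'n \<Rightarrow> bool" where
  "N_matrix A \<longleftrightarrow> (\<forall>K. K \<noteq> {} \<longrightarrow> principal_minor A K < 0)"

definition N_matrix_first_category :: "real^'n^'n \<Rightarrow> 'n set \<Rightarrow> bool" where
  "N_matrix_first_category M J \<longleftrightarrow> N_matrix M \<and> J \<noteq> {} \<and> J \<noteq> UNIV \<and>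
     (\<forall>i\<in>J. \<forall>j\<in>J. M $ i $ j < 0) \<and>
     (\<forall>i\<in>-J. \<forall>j\<in>-J. M $ i $ j < 0) \<and>
     (\<forall>i\<in>J. \<forall>j\<in>-J. M $ i $ j > 0) \<and>
     (\<forall>i\<in>-J. \<forall>j\<in>J. M $ i $ j > 0)"

definition almost_P_matrix_first_category :: "real^'n^'n \<Rightarrow> 'n set \<Rightarrow> bool" where
  "almost_P_matrix_first_category A J \<longleftrightarrow>
     almost_P_matrix A \<and> N_matrix_first_category (matrix_inv A) J"

definition null_space :: "real^'n^'n \<Rightarrow> (real^'n) set" where
  "null_space A = {x. A *v x = 0}"

definition sign_orthant :: "'n set \<Rightarrow> (real^'n) set" where
  "sign_orthant J = {x. (\<forall>j\<in>J. x $ j > 0) \<and> (\<forall>j\<in>-J. x $ j < 0)}"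

end

theory Submission
  imports Defs
begin

text \<open>Principal minors are determinants of matrices in which the other rows are replaced by unit
  rows; in this form Jacobi's identity for the minors of an inverse is multiplicativity of the
  determinant.  With the sign vector \<open>s\<close> of \<open>J\<close>, first category means \<open>s\<^sub>i M\<^sub>i\<^sub>j s\<^sub>j < 0\<close> for
  \<open>M = A\<^sup>-\<^sup>1\<close>, and positivity of the proper principal minors means that \<open>A\<close> reverses the sign of no
  nonzero vector with a zero coordinate.  If \<open>A\<close> reversed the sign of a vector \<open>x\<close> lying in neither
  orthant, one could move \<open>x\<close> along a suitable column of \<open>M\<close>, keeping the reversal, until a first
  coordinate vanishes, a contradiction.  Conversely, \<open>A\<close> reverses the sign of each column of
  \<open>M\<close>, which therefore lies in one of the two orthants.\<close>

section \<open>Principal minors as full determinants\<close>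

definition unit_rows_outside :: "'n set \<Rightarrow> real^'n^'n \<Rightarrow> real^'n^'n" where
  "unit_rows_outside K A = (\<chi> i. if i \<in> K then A $ i else axis i 1)"

text \<open>In the Leibniz sum on the right, a permutation that moves an index outside
  \<open>K\<close> meets an off-diagonal zero of a unit row. The remaining ones permute
  \<open>K\<close>, and the rows outside contribute factors 1.\<close>

lemma principal_minor_eq_det: "principal_minor A K = det (unit_rows_outside K A)"
proof -
  let ?U = "unit_rows_outside K A"
  have "det ?U = (\<Sum>p | p permutes K. of_int (sign p) * (\<Prod>i\<in>UNIV. ?U $ i $ p i))"
    unfolding det_def
  proof (rule sum.mono_neutral_right)
    show "\<forall>p\<in>{p. p permutes UNIV} - {p. p permutes K}.
        of_int (sign p) * (\<Prod>i\<in>UNIV. ?U $ i $ p i) = 0"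
    proof
      fix p assume "p \<in> {p. p permutes (UNIV :: 'a set)} - {p. p permutes K}"
      then obtain i where "i \<notin> K" "p i \<noteq> i"
        unfolding permutes_def by blast
      then have "?U $ i $ p i = 0"
        by (simp add: unit_rows_outside_def axis_def)
      then have "(\<Prod>i\<in>UNIV. ?U $ i $ p i) = 0"
        by (intro prod_zero) auto
      then show "of_int (sign p) * (\<Prod>i\<in>UNIV. ?U $ i $ p i) = 0"
        by simp
    qed
  next
    show "{p. p permutes K} \<subseteq> {p. p permutes (UNIV :: 'a set)}"
      using permutes_subset by blast
  qed simp
  also have "\<dots> = principal_minor A K"
    unfolding principal_minor_def
  proof (rule sum.cong[OF refl])
    fix p assume "p \<in> {p. p permutes K}"
    then have "(\<Prod>i\<in>UNIV. ?U $ i $ p i) = (\<Prod>i\<in>K. A $ i $ p i)"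
      by (intro prod.mono_neutral_cong_right)
        (auto simp: unit_rows_outside_def axis_def permutes_not_in)
    then show "of_int (sign p) * (\<Prod>i\<in>UNIV. ?U $ i $ p i) = of_int (sign p) * (\<Prod>i\<in>K. A $ i $ p i)"
      by simp
  qed
  finally show ?thesis by simp
qed

lemma principal_minor_empty: "principal_minor A {} = 1"
  by (simp add: principal_minor_def)

lemma unit_rows_outside_vector_mult:
  "(unit_rows_outside K A *v x) $ i = (if i \<in> K then (A *v x) $ i else x $ i)"
  by (simp add: unit_rows_outside_def matrix_vector_mult_def axis_def if_distrib[of "\<lambda>a. a * _"]
      cong: if_cong)

text \<open>Jacobi's identity for complementary minors. Right multiplication by \<open>A\<close>
  turns the rows of \<open>M\<close> into unit rows and the unit rows into rows of \<open>A\<close>,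
  so \<open>K\<close> is exchanged with its complement; then determinants are taken.\<close>

lemma principal_minor_inverse:
  fixes A :: "real^'n^'n"
  assumes "M ** A = mat 1"
  shows "principal_minor M K * det A = principal_minor A (- K)"
proof -
  have "unit_rows_outside K M ** A = unit_rows_outside (- K) A"
  proof (rule matrix_eq[THEN iffD2], rule allI)
    fix x :: "real^'n"
    have "M *v (A *v x) = x"
      by (simp add: matrix_vector_mul_assoc assms)
    then show "(unit_rows_outside K M ** A) *v x = unit_rows_outside (- K) A *v x"
      by (simp add: vec_eq_iff matrix_vector_mul_assoc[symmetric] unit_rows_outside_vector_mult)
  qed
  then show ?thesis
    by (simp add: principal_minor_eq_det det_mul[symmetric])
qed

section \<open>Positive principal minors and sign reversal\<close>

lemma principal_minor_add_diagonal_entry: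
  fixes A :: "real^'n^'n"
  shows "principal_minor (\<chi> i. if i = k then A $ i + c *s axis i 1 else A $ i) K =
    principal_minor A K + (if k \<in> K then c * principal_minor A (K - {k}) else 0)"
proof (cases "k \<in> K")
  case True
  let ?U = "\<lambda>i. unit_rows_outside K A $ i"
  have "unit_rows_outside K (\<chi> i. if i = k then A $ i + c *s axis i 1 else A $ i) =
      (\<chi> i. if i = k then A $ i + c *s axis i 1 else ?U i)"
    using True by (auto simp: unit_rows_outside_def vec_eq_iff)
  moreover have "unit_rows_outside K A = (\<chi> i. if i = k then A $ i else ?U i)"
    using True by (auto simp: unit_rows_outside_def vec_eq_iff)
  moreover have "unit_rows_outside (K - {k}) A = (\<chi> i. if i = k then axis i 1 else ?U i)"
    by (auto simp: unit_rows_outside_def vec_eq_iff)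
  ultimately show ?thesis
    using True det_row_add[of k "\<lambda>i. A $ i" "\<lambda>i. c *s axis i 1" ?U]
      det_row_mul[of k c "\<lambda>i. axis i 1" ?U]
    by (simp add: principal_minor_eq_det)
next
  case False
  then have "unit_rows_outside K (\<chi> i. if i = k then A $ i + c *s axis i 1 else A $ i) =
      unit_rows_outside K A"
    by (auto simp: unit_rows_outside_def vec_eq_iff)
  then show ?thesis
    using False by (simp add: principal_minor_eq_det)
qed

text \<open>The entries \<open>d k\<close> are added one at a time. Each adds to the minor of
  \<open>L\<close> either nothing or \<open>d k\<close> times the minor of \<open>L - {k}\<close>,
  so the induction has to carry all subsets of \<open>K\<close> together.\<close>

lemma principal_minor_add_diagonal_pos:
  fixes A :: "real^'n^'n"
  assumes "\<And>L. L \<subseteq> K \<Longrightarrow> principal_minor A L > 0" and "\<And>i. d i \<ge> 0" and "L \<subseteq> K"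
  shows "principal_minor (\<chi> i. A $ i + d i *s axis i 1) L > 0"
proof -
  have "\<forall>L\<subseteq>K. principal_minor (\<chi> i. A $ i + (if i \<in> S then d i else 0) *s axis i 1) L > 0"
    for S :: "'n set"
    using finite[of S]
  proof (induction S rule: finite_induct)
    case empty
    then show ?case using assms(1) by simp
  next
    case (insert k S)
    let ?B = "\<chi> i. A $ i + (if i \<in> S then d i else 0) *s axis i 1"
    have B: "(\<chi> i. A $ i + (if i \<in> insert k S then d i else 0) *s axis i 1) =
        (\<chi> i. if i = k then ?B $ i + d k *s axis i 1 else ?B $ i)"
      using insert.hyps by (auto simp: vec_eq_iff)
    show ?case
    proof (intro allI impI)
      fix L assume "L \<subseteq> K"
      then have "principal_minor ?B L > 0" "principal_minor ?B (L - {k}) > 0"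
        using insert.IH by blast+
      then show "principal_minor
          (\<chi> i. A $ i + (if i \<in> insert k S then d i else 0) *s axis i 1) L > 0"
        unfolding B principal_minor_add_diagonal_entry using assms(2)[of k]
        by (simp add: add_pos_nonneg)
    qed
  qed
  from this[of UNIV] show ?thesis using assms(3) by simp
qed

text \<open>Sign reversal allows a nonnegative diagonal to be added to \<open>A\<close> so that the
  image of \<open>x\<close> vanishes on the support of \<open>x\<close>. The minor of the new matrix
  on the support is still positive, which forces \<open>x = 0\<close>.\<close>

lemma eq_0_if_sign_reversed:
  fixes A :: "real^'n^'n" and x :: "real^'n"
  assumes pos: "\<And>L. L \<subseteq> {i. x $ i \<noteq> 0} \<Longrightarrow> principal_minor A L > 0"
    and rev: "\<And>i. x $ i * (A *v x) $ i \<le> 0"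
  shows "x = 0"
proof -
  let ?K = "{i. x $ i \<noteq> 0}"
  \<comment> \<open>Division by zero gives 0, so \<open>d\<close> vanishes outside the
    support.\<close>
  define d where "d i = - ((A *v x) $ i / x $ i)" for i
  define B where "B = (\<chi> i. A $ i + d i *s axis i 1)"
  have "d i \<ge> 0" for i
    using rev[of i] by (auto simp: d_def divide_le_0_iff mult_le_0_iff)
  then have "principal_minor B ?K > 0"
    unfolding B_def using pos by (intro principal_minor_add_diagonal_pos) auto
  then have "invertible (unit_rows_outside ?K B)"
    by (simp add: principal_minor_eq_det invertible_det_nz)
  moreover have "(B *v x) $ i = (A *v x) $ i + d i * x $ i" for i
    by (simp add: B_def matrix_vector_mult_def axis_def distrib_right sum.distrib
        if_distrib[of "\<lambda>a. _ * a"] if_distrib[of "\<lambda>a. a * _"] cong: if_cong)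
  then have "unit_rows_outside ?K B *v x = 0"
    by (auto simp: vec_eq_iff unit_rows_outside_vector_mult d_def)
  ultimately show ?thesis
    by (metis invertible_def matrix_left_invertible_ker)
qed

text \<open>If \<open>det A\<close> were not positive, some matrix on the segment from the identity
  to \<open>A\<close> would be singular. For a kernel vector \<open>x\<close> of it,
  \<open>A *v x\<close> is a nonpositive multiple of \<open>x\<close>, so \<open>A\<close> reverses
  the sign of \<open>x\<close>.\<close>

lemma det_pos_if_no_sign_reversal:
  fixes A :: "real^'n^'n"
  assumes nonrev: "\<And>x. (\<And>i. x $ i * (A *v x) $ i \<le> 0) \<Longrightarrow> x = 0"
  shows "det A > 0"
proof (rule ccontr)
  assume "\<not> det A > 0"
  define C where "C t = (\<chi> i j. t * A $ i $ j + (1 - t) * mat 1 $ i $ j)" for t :: real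
  have C_mult: "(C t *v x) $ i = t * (A *v x) $ i + (1 - t) * x $ i" for t x i
    by (simp add: C_def matrix_vector_mult_def mat_def distrib_right sum.distrib
        sum_distrib_left mult.assoc if_distrib[of "\<lambda>a. _ * a"] if_distrib[of "\<lambda>a. a * _"]
        cong: if_cong)
  have "continuous_on {0..1} (\<lambda>t. det (C t))"
    unfolding det_def C_def by (auto intro!: continuous_intros)
  moreover have "C 1 = A" "C 0 = mat 1"
    by (simp_all add: C_def vec_eq_iff)
  ultimately obtain t where t: "0 \<le> t" "t \<le> 1" "det (C t) = 0"
    using IVT2'[of "\<lambda>t. det (C t)" 1 0 0] \<open>\<not> det A > 0\<close> by (auto simp: not_less)
  then have "\<not> (\<exists>B. B ** C t = mat 1)"
    using invertible_det_nz[of "C t"] invertible_left_inverse by blast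
  then obtain x where x: "x \<noteq> 0" "C t *v x = 0"
    by (auto simp: matrix_left_invertible_ker)
  have eq: "t * (A *v x) $ i = - ((1 - t) * x $ i)" for i
    using C_mult[of t x i] x(2) by simp
  have "t \<noteq> 0"
    using eq x(1) by (auto simp: vec_eq_iff)
  have "x $ i * (A *v x) $ i \<le> 0" for i
  proof -
    have "t * (x $ i * (A *v x) $ i) = x $ i * (t * (A *v x) $ i)"
      by simp
    also have "\<dots> = - ((1 - t) * (x $ i * x $ i))"
      by (simp only: eq) simp
    also have "\<dots> \<le> 0"
      using t by simp
    finally show ?thesis
      using t \<open>t \<noteq> 0\<close> by (auto simp: mult_le_0_iff)
  qed
  then show False
    using nonrev x(1) by blast
qed

text \<open>Ratio test: the least quotient \<open>a k / b k\<close> is the largest step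
  \<open>t\<close> for which \<open>a - t * b\<close> stays nonnegative on \<open>Q\<close>, and at
  \<open>k\<close> this difference vanishes.\<close>

lemma exists_min_ratio:
  fixes a b :: "'a \<Rightarrow> real"
  assumes "finite Q" "Q \<noteq> {}" "\<And>i. i \<in> Q \<Longrightarrow> a i > 0" "\<And>i. i \<in> Q \<Longrightarrow> b i > 0"
  obtains t k where "t > 0" "k \<in> Q" "t * b k = a k" "\<And>i. i \<in> Q \<Longrightarrow> t * b i \<le> a i"
proof -
  obtain k where k: "k \<in> Q" "\<And>i. i \<in> Q \<Longrightarrow> a k / b k \<le> a i / b i"
    using ex_is_arg_min_if_finite[OF assms(1,2), of "\<lambda>i. a i / b i"]
    by (auto simp: is_arg_min_linorder)
  show thesis
  proof
    show "a k / b k > 0" "k \<in> Q" "a k / b k * b k = a k"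
      using k(1) assms(3,4)[of k] by auto
    show "a k / b k * b i \<le> a i" if "i \<in> Q" for i
      using k(2)[OF that] assms(4)[OF that] by (simp add: pos_le_divide_eq)
  qed
qed

section \<open>Signs with respect to \<open>J\<close>\<close>

definition orthant_sign :: "'n set \<Rightarrow> 'n \<Rightarrow> real" where
  "orthant_sign J i = (if i \<in> J then 1 else - 1)"

lemma orthant_sign_mult_self: "orthant_sign J i * orthant_sign J i = 1"
  by (simp add: orthant_sign_def)

lemma mult_orthant_sign_cancel:
  "(orthant_sign J i * a) * (orthant_sign J i * b) = a * b"
  by (simp add: orthant_sign_def)

lemma mem_sign_orthant_iff: "x \<in> sign_orthant J \<longleftrightarrow> (\<forall>i. orthant_sign J i * x $ i > 0)"
  by (auto simp: sign_orthant_def orthant_sign_def)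

lemma N_matrix_first_category_iff:
  "N_matrix_first_category M J \<longleftrightarrow> N_matrix M \<and> J \<noteq> {} \<and> J \<noteq> UNIV \<and>
    (\<forall>i j. orthant_sign J i * M $ i $ j * orthant_sign J j < 0)"
proof -
  have "(\<forall>i j. Q i j) \<longleftrightarrow> (\<forall>i\<in>J. \<forall>j\<in>J. Q i j) \<and> (\<forall>i\<in>- J. \<forall>j\<in>- J. Q i j) \<and>
      (\<forall>i\<in>J. \<forall>j\<in>- J. Q i j) \<and> (\<forall>i\<in>- J. \<forall>j\<in>J. Q i j)" for Q
    by blast
  from this[of "\<lambda>i j. orthant_sign J i * M $ i $ j * orthant_sign J j < 0"] show ?thesis
    by (simp add: N_matrix_first_category_def orthant_sign_def)
qed

section \<open>Inverses and sign reversal for almost P-matrices\<close>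

lemma column_image:
  fixes A M :: "real^'n^'n"
  assumes "A ** M = mat 1"
  shows "A *v column k M = axis k 1"
proof -
  have "M *v axis k 1 = column k M"
    by (simp add: matrix_vector_mult_basis)
  then show ?thesis
    by (metis assms matrix_vector_mul_assoc matrix_vector_mul_lid)
qed

lemma matrix_inv_inverse:
  assumes "invertible A"
  shows "A ** matrix_inv A = mat 1" "matrix_inv A ** A = mat 1"
  using someI_ex[OF assms[unfolded invertible_def]] by (simp_all add: matrix_inv_def)

text \<open>The support of \<open>x\<close> misses \<open>k\<close>, so only proper principal minors
  enter the criterion for \<open>x = 0\<close>.\<close>

lemma almost_P_matrix_eq_0_if_sign_reversed:
  fixes A :: "real^'n^'n"
  assumes "almost_P_matrix A" "\<And>i. x $ i * (A *v x) $ i \<le> 0" "x $ k = 0"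
  shows "x = 0"
proof (rule eq_0_if_sign_reversed)
  fix L assume "L \<subseteq> {i. x $ i \<noteq> 0}"
  then have "L \<noteq> UNIV"
    using assms(3) by auto
  then show "principal_minor A L > 0"
    using assms(1) by (cases "L = {}") (auto simp: almost_P_matrix_def principal_minor_empty)
qed (rule assms(2))

lemma sign_reversed_in_orthants:
  fixes A M :: "real^'n^'n"
  assumes P: "almost_P_matrix A" and inv: "A ** M = mat 1"
    and neg: "\<And>i j. orthant_sign J i * M $ i $ j * orthant_sign J j < 0"
    and rev: "\<And>i. x $ i * (A *v x) $ i \<le> 0" and nz: "\<And>i. x $ i \<noteq> 0"
  shows "x \<in> sign_orthant J \<or> - x \<in> sign_orthant J"
proof (rule ccontr)
  let ?s = "orthant_sign J"
  assume contra: "\<not> ?thesis"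
  have s_nz: "?s i * x $ i \<noteq> 0" for i
    using nz[of i] by (simp add: orthant_sign_def)
  obtain p where "\<not> ?s p * x $ p < 0"
    using contra by (auto simp: mem_sign_orthant_iff)
  then have p: "?s p * x $ p > 0"
    using s_nz[of p] by linarith
  obtain q where "\<not> ?s q * x $ q > 0"
    using contra by (auto simp: mem_sign_orthant_iff)
  then have q: "?s q * x $ q < 0"
    using s_nz[of q] by linarith
  \<comment> \<open>The factor \<open>- ?s p\<close> puts \<open>w\<close> into the orthant. Moving
    along \<open>w\<close> changes \<open>A *v x\<close> only at \<open>p\<close>, where the signed
    value decreases; this keeps the reversal because the signed coordinate of \<open>x\<close> at
    \<open>p\<close> is positive.\<close>
  define w where "w = - ?s p *s column p M"
  have w_pos: "?s i * w $ i > 0" for i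
    using neg[of i p] by (simp add: w_def column_def mult_ac)
  have Aw: "A *v w = - ?s p *s axis p 1"
    unfolding w_def by (simp only: vector_scalar_commute column_image[OF inv])
  \<comment> \<open>The step \<open>t\<close> ends when the first negative signed coordinate, at
    \<open>k\<close>, reaches zero; no other one becomes positive. Coordinate \<open>p\<close> only
    grows, so the end point \<open>v\<close> is nonzero.\<close>
  obtain t k where t: "t > 0" and k: "?s k * x $ k < 0" "t * (?s k * w $ k) = - (?s k * x $ k)"
    and le: "\<And>i. ?s i * x $ i < 0 \<Longrightarrow> t * (?s i * w $ i) \<le> - (?s i * x $ i)"
    using exists_min_ratio[of "{i. ?s i * x $ i < 0}" "\<lambda>i. - (?s i * x $ i)" "\<lambda>i. ?s i * w $ i"]
      q w_pos by auto
  define v where "v = x + t *s w"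
  have sv: "?s i * v $ i = ?s i * x $ i + t * (?s i * w $ i)" for i
    by (simp add: v_def algebra_simps)
  have sAv: "?s i * (A *v v) $ i = ?s i * (A *v x) $ i - (if i = p then t else 0)" for i
    by (simp add: v_def matrix_vector_right_distrib vector_scalar_commute Aw axis_def
        algebra_simps) (simp add: orthant_sign_def)
  have "v $ i * (A *v v) $ i \<le> 0" for i
  proof -
    have r: "(?s i * x $ i) * (?s i * (A *v x) $ i) \<le> 0"
      using rev[of i] by (simp only: mult_orthant_sign_cancel)
    have "(?s i * v $ i) * (?s i * (A *v v) $ i) \<le> 0"
    proof (cases "?s i * x $ i > 0")
      case True
      then have "?s i * v $ i > 0"
        using t w_pos[of i] by (simp add: sv add_pos_pos)
      moreover have "?s i * (A *v x) $ i \<le> 0"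
        using r True mult_pos_pos[OF True] by (meson not_less)
      ultimately show ?thesis
        using t sAv[of i] by - (rule mult_nonneg_nonpos, auto)
    next
      case False
      then have neg_i: "?s i * x $ i < 0"
        using s_nz[of i] by linarith
      then have "?s i * v $ i \<le> 0"
        using le[of i] by (simp add: sv)
      moreover have "?s i * (A *v x) $ i \<ge> 0"
        using r mult_neg_neg[OF neg_i] by (meson not_less)
      moreover have "i \<noteq> p"
        using False p by auto
      ultimately show ?thesis
        using sAv[of i] by - (rule mult_nonpos_nonneg, auto)
    qed
    then show ?thesis
      by (simp only: mult_orthant_sign_cancel)
  qed
  moreover have "?s k * v $ k = 0"
    using k(2) by (simp add: sv)
  then have "v $ k = 0"
    by (simp add: orthant_sign_def split: if_splits)
  ultimately have "v = 0"
    using almost_P_matrix_eq_0_if_sign_reversed[OF P] by blast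
  moreover have "?s p * v $ p > 0"
    using p t w_pos[of p] by (simp add: sv add_pos_pos)
  ultimately show False
    by simp
qed

lemma almost_P_matrix_if_sign_reversal:
  fixes A :: "real^'n^'n"
  assumes card: "CARD('n) \<ge> 2"
    and nonrev: "\<And>x k. (\<And>i. x $ i * (A *v x) $ i \<le> 0) \<Longrightarrow> x $ k = 0 \<Longrightarrow> x = 0"
    and ker: "\<And>x. A *v x = 0 \<Longrightarrow> x = 0"
    and u: "u \<noteq> 0" "\<And>i. u $ i * (A *v u) $ i \<le> 0"
  shows "almost_P_matrix A"
proof -
  have proper: "principal_minor A K > 0" if "K \<noteq> UNIV" for K
    unfolding principal_minor_eq_det
  proof (rule det_pos_if_no_sign_reversal)
    fix x :: "real^'n"
    assume rev: "\<And>i. x $ i * (unit_rows_outside K A *v x) $ i \<le> 0"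
    \<comment> \<open>Outside \<open>K\<close> the row is a unit row, and the reversal reads
      \<open>x $ i * x $ i \<le> 0\<close>.\<close>
    have out: "x $ i = 0" if "i \<notin> K" for i
      using rev[of i] that by (simp add: unit_rows_outside_vector_mult mult_le_0_iff) linarith
    have "x $ i * (A *v x) $ i \<le> 0" for i
      using rev[of i] out[of i] by (cases "i \<in> K") (simp_all add: unit_rows_outside_vector_mult)
    then show "x = 0"
      using nonrev out \<open>K \<noteq> UNIV\<close> by blast
  qed
  have "det A \<noteq> 0"
    using ker matrix_left_invertible_ker[of A] by (auto simp: invertible_left_inverse simp flip: invertible_det_nz)
  \<comment> \<open>A positive determinant would make all principal minors positive, and then the
    reversed vector \<open>u\<close> would be zero.\<close>
  moreover have "\<not> det A > 0"
  proof
    assume "det A > 0"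
    then have "principal_minor A L > 0" for L
      using proper[of L] by (cases "L = UNIV") (auto simp: principal_minor_UNIV)
    then show False
      using eq_0_if_sign_reversed u by blast
  qed
  ultimately show ?thesis
    using card proper by (auto simp: almost_P_matrix_def)
qed

text \<open>By Jacobi's identity each minor of \<open>M\<close> is a minor of \<open>A\<close> on a
  proper index set, possibly empty with value 1, divided by the negative
  \<open>det A\<close>.\<close>

lemma almost_P_matrix_inverse_N_matrix:
  fixes A M :: "real^'n^'n"
  assumes "almost_P_matrix A" "M ** A = mat 1"
  shows "N_matrix M"
  unfolding N_matrix_def
proof (intro allI impI)
  fix K :: "'n set" assume "K \<noteq> {}"
  have "principal_minor A (- K) > 0"
  proof (cases "K = UNIV")
    case True
    then show ?thesis by (simp add: principal_minor_empty)
  next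
    case False
    then have "- K \<noteq> {}" "- K \<noteq> UNIV"
      using \<open>K \<noteq> {}\<close> by blast+
    moreover have "principal_minor A L > 0" if "L \<noteq> {}" "L \<noteq> UNIV" for L
      using assms(1) that by (simp add: almost_P_matrix_def)
    ultimately show ?thesis
      by (simp only: not_False_eq_True)
  qed
  then have "principal_minor M K * det A > 0"
    by (simp add: principal_minor_inverse[OF assms(2)])
  then show "principal_minor M K < 0"
    using assms(1) by (auto simp: almost_P_matrix_def zero_less_mult_iff)
qed

section \<open>Equivalence of first category with (a), (b) and (c)\<close>

theorem theorem4p4:
  fixes A :: "real^'n^'n" and J :: "'n set"
  assumes "J \<noteq> {}" and "J \<noteq> UNIV"
  shows "almost_P_matrix_first_category A J \<longleftrightarrow>
    null_space A \<inter> sign_orthant J = {} \<and>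
    (\<forall>x. (\<forall>i. x $ i * (A *v x) $ i \<le> 0) \<longrightarrow>
       (if \<exists>k. x $ k = 0 then x = 0 else x \<in> sign_orthant J \<or> - x \<in> sign_orthant J)) \<and>
    (\<lambda>x. A *v x) ` sign_orthant J \<inter> uminus ` sign_orthant J \<noteq> {}"
    (is "_ \<longleftrightarrow> ?a \<and> ?b \<and> ?c")
proof
  let ?s = "orthant_sign J" and ?M = "matrix_inv A"
  assume "almost_P_matrix_first_category A J"
  then have P: "almost_P_matrix A"
    and neg: "\<And>i j. ?s i * ?M $ i $ j * ?s j < 0"
    by (auto simp: almost_P_matrix_first_category_def N_matrix_first_category_iff)
  then have "invertible A"
    by (auto simp: invertible_det_nz almost_P_matrix_def)
  then have AM: "A ** ?M = mat 1" and MA: "?M ** A = mat 1"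
    by (rule matrix_inv_inverse)+
  have ?a
  proof -
    have "x = 0" if "A *v x = 0" for x
      using that MA by (metis matrix_left_invertible_ker)
    then show ?thesis
      by (auto simp: null_space_def mem_sign_orthant_iff) fastforce
  qed
  moreover have ?b
  proof (intro allI impI)
    fix x assume rev: "\<forall>i. x $ i * (A *v x) $ i \<le> 0"
    show "if \<exists>k. x $ k = 0 then x = 0 else x \<in> sign_orthant J \<or> - x \<in> sign_orthant J"
      using almost_P_matrix_eq_0_if_sign_reversed[OF P] sign_reversed_in_orthants[OF P AM neg] rev
      by auto
  qed
  moreover have ?c
  proof -
    \<comment> \<open>The witness for (c) is the preimage of \<open>- z\<close> for the sign vector
      \<open>z\<close>: its signed coordinates are the negated row sums of the signed inverse, all
      of whose entries are negative.\<close>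
    define z :: "real^'n" where "z = (\<chi> i. ?s i)"
    have z: "z \<in> sign_orthant J"
      by (simp add: mem_sign_orthant_iff z_def orthant_sign_mult_self)
    have "?s i * (?M *v - z) $ i > 0" for i
    proof -
      have "?s i * (?M *v - z) $ i = - (\<Sum>j\<in>UNIV. ?s i * ?M $ i $ j * ?s j)"
        by (simp add: matrix_vector_mult_def z_def sum_distrib_left sum_negf mult.assoc)
      also have "\<dots> > 0"
        using neg by (simp add: sum_strict_mono[of UNIV _ "\<lambda>_. 0", simplified])
      finally show ?thesis .
    qed
    then have "?M *v - z \<in> sign_orthant J"
      by (simp add: mem_sign_orthant_iff)
    moreover have "A *v (?M *v - z) = - z"
      by (simp add: matrix_vector_mul_assoc AM)
    ultimately show ?thesis
      using z by force
  qed
  ultimately show "?a \<and> ?b \<and> ?c" by blast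
next
  let ?s = "orthant_sign J" and ?M = "matrix_inv A"
  assume abc: "?a \<and> ?b \<and> ?c"
  have nonrev: "x = 0" if "\<And>i. x $ i * (A *v x) $ i \<le> 0" "x $ k = 0" for x k
    using abc that by (metis (no_types, lifting))
  have orthants: "x \<in> sign_orthant J \<or> - x \<in> sign_orthant J"
    if "\<And>i. x $ i * (A *v x) $ i \<le> 0" "x \<noteq> 0" for x
    using abc that by (metis (no_types, lifting))
  \<comment> \<open>A kernel vector is trivially sign reversed, so by (b) a nonzero one lies in the
    orthant up to sign, which (a) excludes.\<close>
  have ker: "x = 0" if "A *v x = 0" for x
  proof (rule ccontr)
    assume "x \<noteq> 0"
    then have "x \<in> sign_orthant J \<or> - x \<in> sign_orthant J"
      using that by (intro orthants) auto
    moreover have "A *v - x = 0"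
      using that by (simp add: vec_eq_iff matrix_vector_mult_def sum_negf)
    ultimately show False
      using abc that by (auto simp: null_space_def)
  qed
  \<comment> \<open>Condition (c) supplies the nonzero reversed vector that rules out a positive
    determinant.\<close>
  obtain u where u: "u \<in> sign_orthant J" "- (A *v u) \<in> sign_orthant J"
  proof -
    obtain x y where "x \<in> sign_orthant J" "y \<in> sign_orthant J" "A *v x = - y"
      using abc by auto
    then show thesis
      by (intro that[of x]) simp_all
  qed
  have "u $ i * (A *v u) $ i \<le> 0" for i
  proof -
    have "(?s i * u $ i) * (?s i * (A *v u) $ i) \<le> 0"
      using u by - (rule mult_nonneg_nonpos, auto simp: mem_sign_orthant_iff less_imp_le)
    then show ?thesis by (simp only: mult_orthant_sign_cancel)
  qed
  moreover have "u \<noteq> 0"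
    using u(1) by (auto simp: mem_sign_orthant_iff)
  moreover have "CARD('n) \<ge> 2"
  proof -
    obtain i j where "i \<in> J" "j \<notin> J"
      using assms by blast
    then have "i \<noteq> j" by blast
    then have "card {i, j} = 2" by simp
    then show ?thesis
      by (metis card_mono finite subset_UNIV)
  qed
  ultimately have P: "almost_P_matrix A"
    using almost_P_matrix_if_sign_reversal[of A u] nonrev ker by blast
  then have "invertible A"
    by (auto simp: invertible_det_nz almost_P_matrix_def)
  then have AM: "A ** ?M = mat 1" and MA: "?M ** A = mat 1"
    by (rule matrix_inv_inverse)+
  have N: "N_matrix ?M"
    using almost_P_matrix_inverse_N_matrix P MA by blast
  have "?s i * ?M $ i $ k * ?s k < 0" for i k
  proof -
    have diag: "?M $ k $ k < 0"
      using N by (metis N_matrix_def insert_not_empty principal_minor_singleton)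
    \<comment> \<open>\<open>A\<close> sends this column to the unit vector at \<open>k\<close>, so
      the only nonzero product is the diagonal entry, which is negative.\<close>
    let ?x = "column k ?M"
    have "?x $ i * (A *v ?x) $ i \<le> 0" for i
      using diag by (simp add: column_image[OF AM] axis_def) (simp add: column_def)
    moreover have "?x \<noteq> 0"
      using diag by (auto simp: column_def vec_eq_iff intro!: exI[of _ k])
    ultimately have "?x \<in> sign_orthant J \<or> - ?x \<in> sign_orthant J"
      by (rule orthants)
    \<comment> \<open>In either orthant all signed coordinates of the column share one sign; the
      diagonal entry then determines it.\<close>
    then have "0 < (?s i * ?x $ i) * (?s k * ?x $ k)"
      by (auto simp: mem_sign_orthant_iff intro: mult_neg_neg)
    also have "\<dots> = (?s i * ?M $ i $ k * ?s k) * ?M $ k $ k"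
      by (simp add: column_def)
    finally show ?thesis
      using diag by (auto simp: zero_less_mult_iff)
  qed
  then show "almost_P_matrix_first_category A J"
    using P N assms by (simp add: almost_P_matrix_first_category_def N_matrix_first_category_iff)
qed

end
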